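(* R(lin) is implicationally complete: for every collection $D_0,D_1,\dots,D_m$ of disjunctions of linear equations, if $D_1,\dots,D_m\models D_0$, then there is an R(lin) proof of $D_0$ from $D_1,\dots,D_m$.
   Context: Linear equations $a_1x_1+\dots+a_nx_n=a_0$ have integer coefficients (an equation with no variables has the form $0=a_0$). A disjunction of linear equations (duplicates discarded) is satisfied by an assignment iff some equation in it holds; the empty disjunction is false. $D_1,\dots,D_m\models D_0$ means every $0,1$ assignment satisfying all $D_1,\dots,D_m$ satisfies $D_0$. An R(lin) proof of $D$ from $K$: a sequence of disjunctions ending in $D$, each in $K$, a Boolean axiom $(x_h=0)\vee(x_h=1)$, or derived from earlier lines by Resolution (from $A\vee L_1$, $B\vee L_2$ derive $A\vee B\vee(L_1+L_2)$ or $A\vee B\vee(L_1-L_2)$, adding/subtracting equations side by side), Weakening (from $A$ derive $A\vee L$ for any linear equation $L$), or Simplification (from $A\vee(0=k)$, $k\ne0$, derive $A$); $A,B$ may be empty. *)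

theory Defs
  imports "HOL-Library.Poly_Mapping" "HOL-Library.Product_Plus" "HOL-Library.FSet"
begin

text \<open>
  The pair \<open>(a, c)\<close> stands for the equation \<open>\<Sum>v. a v * x v = c\<close>, with finitely many variables
  occurring, so that \<open>(0, c)\<close> is the equation \<open>0 = c\<close>.  The pointwise operations on pairs
  add and subtract equations side by side.
\<close>
type_synonym 'v lineq = "('v \<Rightarrow>\<^sub>0 int) \<times> int"

text \<open>Duplicates (and the order of disjuncts) are discarded by using finite sets.\<close>
type_synonym 'v disj = "'v lineq fset"

definition sat_eq :: "('v \<Rightarrow> int) \<Rightarrow> 'v lineq \<Rightarrow> bool" where
  "sat_eq \<sigma> L \<longleftrightarrow>
     (\<Sum>v\<in>Poly_Mapping.keys (fst L). Poly_Mapping.lookup (fst L) v * \<sigma> v) = snd L"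

definition sat_disj :: "('v \<Rightarrow> int) \<Rightarrow> 'v disj \<Rightarrow> bool" where
  "sat_disj \<sigma> D \<longleftrightarrow> (\<exists>L. L |\<in>| D \<and> sat_eq \<sigma> L)"

definition entails :: "'v disj set \<Rightarrow> 'v disj \<Rightarrow> bool" where
  "entails K D \<longleftrightarrow>
     (\<forall>\<sigma>. (\<forall>v. \<sigma> v \<in> {0, 1}) \<longrightarrow> (\<forall>E\<in>K. sat_disj \<sigma> E) \<longrightarrow> sat_disj \<sigma> D)"

definition boolean_axiom :: "'v \<Rightarrow> 'v disj" where
  "boolean_axiom h = {|(Poly_Mapping.single h 1, 0), (Poly_Mapping.single h 1, 1)|}"

text \<open>
  \<open>rlin_step P D\<close>: \<open>D\<close> follows by one rule application from premises in \<open>P\<close>.  The side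
  disjunctions \<open>A\<close>, \<open>B\<close> are arbitrary finite sets; they may be empty, and they may
  contain the equation that the rule acts on.
\<close>
inductive rlin_step :: "'v disj set \<Rightarrow> 'v disj \<Rightarrow> bool" for P where
  resolution_add:
    "finsert L1 A \<in> P \<Longrightarrow> finsert L2 B \<in> P \<Longrightarrow> rlin_step P (finsert (L1 + L2) (A |\<union>| B))"
| resolution_diff:
    "finsert L1 A \<in> P \<Longrightarrow> finsert L2 B \<in> P \<Longrightarrow> rlin_step P (finsert (L1 - L2) (A |\<union>| B))"
| weakening: "A \<in> P \<Longrightarrow> rlin_step P (finsert L A)"
| simplification: "finsert (0, k) A \<in> P \<Longrightarrow> k \<noteq> 0 \<Longrightarrow> rlin_step P A"

definition rlin_proof :: "'v disj set \<Rightarrow> 'v disj list \<Rightarrow> 'v disj \<Rightarrow> bool" where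
  "rlin_proof K \<pi> D \<longleftrightarrow> \<pi> \<noteq> [] \<and> last \<pi> = D \<and>
     (\<forall>i<length \<pi>. \<pi> ! i \<in> K \<or> (\<exists>h. \<pi> ! i = boolean_axiom h) \<or>
                    rlin_step (set (take i \<pi>)) (\<pi> ! i))"

end

theory Submission imports Defs begin

text \<open>
  For a 0/1 assignment \<open>\<sigma>\<close> to the finitely many variables that occur, let \<open>C\<close> be the disjunction
  of the equations \<open>x\<^sub>v = 1 - \<sigma> v\<close>, which is falsified by \<open>\<sigma>\<close> only.  Modulo \<open>C\<close>, the Boolean axioms yield \<open>x\<^sub>v = \<sigma> v\<close>, hence by integer
  combination every equation true under \<open>\<sigma>\<close>.  Subtracting these from the disjuncts of a premise
  that is false under \<open>\<sigma>\<close> turns each disjunct into \<open>0 = k\<close> with \<open>k \<noteq> 0\<close> and so refutes it, leaving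
  \<open>C\<close>; if all premises hold under \<open>\<sigma>\<close>, then a disjunct of the conclusion is derived
  modulo \<open>C\<close>.  Finally the disjunctions \<open>C\<close> for all \<open>\<sigma>\<close> are resolved away one variable at a time.
\<close>

definition derivable :: "'v disj set \<Rightarrow> 'v disj \<Rightarrow> bool" where
  "derivable K D \<longleftrightarrow> (\<exists>\<pi>. rlin_proof K \<pi> D)"

lemma rlin_step_mono: "rlin_step P D \<Longrightarrow> P \<subseteq> Q \<Longrightarrow> rlin_step Q D"
  by (induction rule: rlin_step.induct) (auto intro: rlin_step.intros)

text \<open>The line condition of \<open>rlin_proof\<close> alone. With no prescribed last line it
  is preserved by concatenation, and it holds for the empty list.\<close>

definition valid_lines :: "'v disj set \<Rightarrow> 'v disj list \<Rightarrow> bool" where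
  "valid_lines K \<pi> \<longleftrightarrow> (\<forall>i<length \<pi>. \<pi> ! i \<in> K \<or> (\<exists>h. \<pi> ! i = boolean_axiom h) \<or>
     rlin_step (set (take i \<pi>)) (\<pi> ! i))"

lemma valid_lines_append:
  assumes "valid_lines K \<pi>" "valid_lines K \<rho>"
  shows "valid_lines K (\<pi> @ \<rho>)"
  unfolding valid_lines_def
proof (intro allI impI)
  fix i assume i: "i < length (\<pi> @ \<rho>)"
  show "(\<pi> @ \<rho>) ! i \<in> K \<or> (\<exists>h. (\<pi> @ \<rho>) ! i = boolean_axiom h) \<or>
     rlin_step (set (take i (\<pi> @ \<rho>))) ((\<pi> @ \<rho>) ! i)"
  proof (cases "i < length \<pi>")
    case True
    then show ?thesis
      using assms(1) by (auto simp: valid_lines_def nth_append)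
  next
    case False
    then have "i - length \<pi> < length \<rho>"
      using i by auto
    then have "\<rho> ! (i - length \<pi>) \<in> K \<or> (\<exists>h. \<rho> ! (i - length \<pi>) = boolean_axiom h) \<or>
       rlin_step (set (take (i - length \<pi>) \<rho>)) (\<rho> ! (i - length \<pi>))"
      using assms(2) by (auto simp: valid_lines_def)
    then show ?thesis
      using False rlin_step_mono[of "set (take (i - length \<pi>) \<rho>)" _ "set (take i (\<pi> @ \<rho>))"]
      by (auto simp: nth_append)
  qed
qed

text \<open>Proofs of the premises are concatenated and \<open>D\<close> is appended; finiteness of
  \<open>P\<close> keeps the result a list.\<close>

lemma derivable_step:
  assumes "finite P" "\<And>E. E \<in> P \<Longrightarrow> derivable K E" "rlin_step P D"
  shows "derivable K D"
proof -
  have "\<exists>\<pi>. valid_lines K \<pi> \<and> P \<subseteq> set \<pi>"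
    using assms(1,2)
  proof (induction P)
    case empty
    show ?case by (auto simp: valid_lines_def intro: exI[of _ "[]"])
  next
    case (insert E P)
    then obtain \<pi> where \<pi>: "valid_lines K \<pi>" "P \<subseteq> set \<pi>"
      by blast
    obtain \<rho> where "rlin_proof K \<rho> E"
      using insert.prems by (auto simp: derivable_def)
    then have "valid_lines K \<rho>" "E \<in> set \<rho>"
      by (auto simp: rlin_proof_def valid_lines_def)
    with \<pi> show ?case
      by (intro exI[of _ "\<pi> @ \<rho>"]) (auto intro: valid_lines_append)
  qed
  then obtain \<pi> where "valid_lines K \<pi>" "P \<subseteq> set \<pi>"
    by blast
  then have "rlin_proof K (\<pi> @ [D]) D"
    using rlin_step_mono[OF assms(3)]
    by (auto simp: rlin_proof_def valid_lines_def nth_append less_Suc_eq)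
  then show ?thesis
    by (auto simp: derivable_def)
qed

lemma derivable_premise: "D \<in> K \<Longrightarrow> derivable K D"
  unfolding derivable_def by (intro exI[of _ "[D]"]) (auto simp: rlin_proof_def)

lemma derivable_boolean_axiom: "derivable K (boolean_axiom h)"
  unfolding derivable_def by (intro exI[of _ "[boolean_axiom h]"]) (auto simp: rlin_proof_def)

lemma derivable_add:
  assumes "derivable K (finsert L1 A)" "derivable K (finsert L2 B)"
  shows "derivable K (finsert (L1 + L2) (A |\<union>| B))"
  by (rule derivable_step[of "{finsert L1 A, finsert L2 B}"])
    (use assms in \<open>auto intro: rlin_step.resolution_add\<close>)

lemma derivable_diff:
  assumes "derivable K (finsert L1 A)" "derivable K (finsert L2 B)"
  shows "derivable K (finsert (L1 - L2) (A |\<union>| B))"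
  by (rule derivable_step[of "{finsert L1 A, finsert L2 B}"])
    (use assms in \<open>auto intro: rlin_step.resolution_diff\<close>)

lemma derivable_finsert: "derivable K A \<Longrightarrow> derivable K (finsert L A)"
  by (rule derivable_step[of "{A}"]) (auto intro: rlin_step.weakening)

lemma derivable_simplification:
  "derivable K (finsert (0, k) A) \<Longrightarrow> k \<noteq> 0 \<Longrightarrow> derivable K A"
  by (rule derivable_step[of "{finsert (0, k) A}"]) (auto intro: rlin_step.simplification)

lemma derivable_mono:
  assumes "derivable K A" "A |\<subseteq>| B"
  shows "derivable K B"
proof -
  have "derivable K (A |\<union>| C)" for C
    by (induction C) (use assms(1) in \<open>auto intro: derivable_finsert\<close>)
  moreover have "A |\<union>| B = B"
    using assms(2) by auto
  ultimately show ?thesis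
    by metis
qed

text \<open>This is the starting point 0 = 0 for integer combinations. Resolving the Boolean axiom
  of an arbitrary variable with itself, first on one disjunct and then on the other, subtracts each
  equation from itself.\<close>

lemma derivable_zero: "derivable K {|0|}"
proof -
  fix h :: 'a
  let ?L = "\<lambda>c. (Poly_Mapping.single h 1, c) :: 'a lineq"
  have ax: "derivable K (finsert (?L 0) {|?L 1|})"
    using derivable_boolean_axiom[of K h] by (simp add: boolean_axiom_def)
  have "derivable K (finsert (?L 1) {|0|})"
    using derivable_diff[OF ax ax] by (simp add: finsert_commute)
  from derivable_diff[OF this this] show ?thesis
    by simp
qed

definition falsified_by :: "'v fset \<Rightarrow> ('v \<Rightarrow> int) \<Rightarrow> 'v disj" where
  "falsified_by V \<sigma> = (\<lambda>v. (Poly_Mapping.single v 1, 1 - \<sigma> v)) |`| V"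

lemma derivable_add_same:
  "derivable K (finsert L1 C) \<Longrightarrow> derivable K (finsert L2 C) \<Longrightarrow> derivable K (finsert (L1 + L2) C)"
  using derivable_add[of K L1 C L2 C] by simp

lemma derivable_diff_same:
  "derivable K (finsert L1 C) \<Longrightarrow> derivable K (finsert L2 C) \<Longrightarrow> derivable K (finsert (L1 - L2) C)"
  using derivable_diff[of K L1 C L2 C] by simp

lemma derivable_zero_finsert: "derivable K (finsert 0 C)"
  by (rule derivable_mono[OF derivable_zero]) auto

lemma derivable_single:
  assumes "\<sigma> v \<in> {0, 1}" "v |\<in>| V"
  shows "derivable K (finsert (Poly_Mapping.single v n, n * \<sigma> v) (falsified_by V \<sigma>))"
proof -
  \<comment> \<open>As \<open>\<sigma> v\<close> is 0 or 1, the Boolean axiom consists of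
    \<open>x_v = \<sigma> v\<close> and \<open>x_v = 1 - \<sigma> v\<close>, and the latter belongs
    to \<open>falsified_by V \<sigma>\<close>.\<close>
  have unit: "derivable K (finsert (Poly_Mapping.single v 1, \<sigma> v) (falsified_by V \<sigma>))"
    by (rule derivable_mono[OF derivable_boolean_axiom[of K v]])
      (use assms in \<open>auto simp: boolean_axiom_def falsified_by_def\<close>)
  show ?thesis
  proof (induction n rule: int_induct[where k = 0])
    case base
    show ?case
      using derivable_zero_finsert by (simp add: zero_prod_def)
  next
    case (step1 i)
    from derivable_add_same[OF step1(2) unit] show ?case
      by (simp add: single_add algebra_simps)
  next
    case (step2 i)
    from derivable_diff_same[OF step2(2) unit] show ?case
      by (simp add: single_diff algebra_simps)
  qed
qed

lemma derivable_sum: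
  assumes "\<And>i. i \<in> I \<Longrightarrow> derivable K (finsert (f i) C)"
  shows "derivable K (finsert (sum f I) C)"
  using assms
  by (induction I rule: infinite_finite_induct)
    (auto intro: derivable_zero_finsert derivable_add_same)

lemma sum_single_lookup:
  "(\<Sum>v\<in>Poly_Mapping.keys a. Poly_Mapping.single v (Poly_Mapping.lookup a v)) = a"
  by (rule poly_mapping_eqI)
    (auto simp: lookup_sum lookup_single when_def in_keys_iff sum.delta)

lemma derivable_true_eq:
  assumes "\<forall>v. \<sigma> v \<in> {0, 1}" "Poly_Mapping.keys (fst L) \<subseteq> fset V" "sat_eq \<sigma> L"
  shows "derivable K (finsert L (falsified_by V \<sigma>))"
proof -
  let ?a = "Poly_Mapping.lookup (fst L)"
  \<comment> \<open>The left sides agree for every \<open>L\<close>; the right sides agree because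
    \<open>\<sigma>\<close> satisfies \<open>L\<close>.\<close>
  have "L = (\<Sum>v\<in>Poly_Mapping.keys (fst L). (Poly_Mapping.single v (?a v), ?a v * \<sigma> v))"
    using assms(3) sum_single_lookup[of "fst L"]
    by (simp add: prod_eq_iff fst_sum snd_sum sat_eq_def)
  moreover have "derivable K (finsert (\<Sum>v\<in>Poly_Mapping.keys (fst L).
      (Poly_Mapping.single v (?a v), ?a v * \<sigma> v)) (falsified_by V \<sigma>))"
    by (rule derivable_sum) (use assms in \<open>auto intro!: derivable_single\<close>)
  ultimately show ?thesis
    by metis
qed

lemma derivable_falsified_by:
  assumes "\<forall>v. \<sigma> v \<in> {0, 1}" "\<And>L. L |\<in>| E \<Longrightarrow> Poly_Mapping.keys (fst L) \<subseteq> fset V"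
    and "\<not> sat_disj \<sigma> E" "derivable K E"
  shows "derivable K (falsified_by V \<sigma>)"
proof -
  have "derivable K (E |\<union>| falsified_by V \<sigma>)"
    by (rule derivable_mono[OF assms(4)]) auto
  moreover have "\<And>L. L |\<in>| E \<Longrightarrow> \<not> sat_eq \<sigma> L"
    using assms(3) by (auto simp: sat_disj_def)
  \<comment> \<open>The induction strips the disjuncts of \<open>E\<close> one by one. It keeps
    \<open>falsified_by V \<sigma>\<close> beside \<open>E\<close>, since every subtraction brings
    it in as a side disjunction.\<close>
  ultimately show ?thesis
    using assms(2)
  proof (induction E)
    case empty
    then show ?case by simp
  next
    case (insert L E)
    \<comment> \<open>\<open>s\<close> is the value of the left side under \<open>\<sigma>\<close>,
      so \<open>(fst L, s)\<close> is true under \<open>\<sigma>\<close>, while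
      \<open>snd L - s\<close> is nonzero because \<open>L\<close> is false.\<close>
    define s where "s = (\<Sum>v\<in>Poly_Mapping.keys (fst L). Poly_Mapping.lookup (fst L) v * \<sigma> v)"
    have "\<not> sat_eq \<sigma> L" "Poly_Mapping.keys (fst L) \<subseteq> fset V"
      using insert.prems by auto
    then have s: "snd L - s \<noteq> 0" and
      der: "derivable K (finsert (fst L, s) (falsified_by V \<sigma>))"
      using assms(1) by (auto intro!: derivable_true_eq simp: sat_eq_def s_def)
    have "L - (fst L, s) = (0, snd L - s)"
      by (simp add: prod_eq_iff)
    then have "derivable K (finsert (0, snd L - s) (E |\<union>| falsified_by V \<sigma>))"
      using derivable_diff[of K L "E |\<union>| falsified_by V \<sigma>", OF _ der] insert.prems(1)
      by (simp add: sup_assoc)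
    then have "derivable K (E |\<union>| falsified_by V \<sigma>)"
      using s by (rule derivable_simplification)
    with insert show ?case
      by auto
  qed
qed

text \<open>Two assignments that differ only at \<open>w\<close> give disjunctions that differ only
  in \<open>x_w = 1\<close> versus \<open>x_w = 0\<close>. Subtracting these yields 0 = 1, which
  simplification deletes, so \<open>w\<close> is eliminated.\<close>

lemma derivable_if_all_falsified_by:
  assumes "\<And>\<sigma>. \<forall>v. \<sigma> v \<in> {0, 1} \<Longrightarrow> derivable K (falsified_by V \<sigma> |\<union>| D)"
  shows "derivable K D"
  using assms
proof (induction V)
  case empty
  \<comment> \<open>Without variables the disjunction is empty for every assignment, so any 0/1
    assignment serves.\<close>
  from empty[of "\<lambda>_. 0"] show ?case
    by (simp add: falsified_by_def)
next
  case (insert w V)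
  show ?case
  proof (rule insert.IH)
    fix \<sigma> :: "'a \<Rightarrow> int" assume \<sigma>: "\<forall>v. \<sigma> v \<in> {0, 1}"
    let ?C = "falsified_by V \<sigma> |\<union>| D"
    \<comment> \<open>As \<open>w\<close> is not in \<open>V\<close>, the update at \<open>w\<close>
      leaves the equations for \<open>V\<close> unchanged.\<close>
    have "falsified_by (finsert w V) (\<sigma>(w := c)) =
        finsert (Poly_Mapping.single w 1, 1 - c) (falsified_by V \<sigma>)" for c
      using insert.hyps by (auto simp: falsified_by_def intro!: fimage_cong)
    then have "derivable K (finsert (Poly_Mapping.single w 1, 1 - c) ?C)" if "c \<in> {0, 1}" for c
      using insert.prems[of "\<sigma>(w := c)"] \<sigma> that by (simp del: fun_upd_apply) simp
    from this[of 0] this[of 1]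
    have "derivable K (finsert (Poly_Mapping.single w 1, 1) ?C)"
      "derivable K (finsert (Poly_Mapping.single w 1, 0) ?C)"
      by simp_all
    from derivable_diff_same[OF this] have "derivable K (finsert (0, 1) ?C)"
      by simp
    then show "derivable K ?C"
      by (rule derivable_simplification) simp
  qed
qed

lemma derivable_if_entails:
  assumes "finite K" "entails K D"
  shows "derivable K D"
proof -
  \<comment> \<open>The variables of \<open>D\<close> are included because a true disjunct of
    \<open>D\<close> is later built from the equations for the variables in
    \<open>V\<close>.\<close>
  have "finite (\<Union>E\<in>insert D K. \<Union>L\<in>fset E. Poly_Mapping.keys (fst L))"
    using assms(1) by auto
  then obtain V where V: "fset V = (\<Union>E\<in>insert D K. \<Union>L\<in>fset E. Poly_Mapping.keys (fst L))"
    by (metis fset_cases mem_Collect_eq)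
  show ?thesis
  proof (rule derivable_if_all_falsified_by[of _ V])
    fix \<sigma> :: "'a \<Rightarrow> int" assume \<sigma>: "\<forall>v. \<sigma> v \<in> {0, 1}"
    show "derivable K (falsified_by V \<sigma> |\<union>| D)"
    proof (cases "\<forall>E\<in>K. sat_disj \<sigma> E")
      case True
      then obtain L where L: "L |\<in>| D" "sat_eq \<sigma> L"
        using assms(2) \<sigma> unfolding entails_def sat_disj_def by blast
      have "derivable K (finsert L (falsified_by V \<sigma>))"
        by (rule derivable_true_eq[OF \<sigma> _ L(2)]) (use V L(1) in auto)
      then show ?thesis
        by (rule derivable_mono) (use L(1) in auto)
    next
      case False
      then obtain E where E: "E \<in> K" "\<not> sat_disj \<sigma> E"
        by blast
      have "derivable K (falsified_by V \<sigma>)"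
        by (rule derivable_falsified_by[OF \<sigma> _ E(2) derivable_premise[OF E(1)]])
          (use V E(1) in auto)
      then show ?thesis
        by (rule derivable_mono) auto
    qed
  qed
qed

theorem theorem5p1:
  fixes D :: "nat \<Rightarrow> 'v disj" and m :: nat
  assumes "entails (D ` {1..m}) (D 0)"
  shows "\<exists>\<pi>. rlin_proof (D ` {1..m}) \<pi> (D 0)"
  using derivable_if_entails[OF _ assms] by (simp add: derivable_def)

end
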